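(* The filter monad $\mathsf{F}$, regarded as an $\mathbf{Ord}$-monad on the $\mathbf{Ord}$-category $\mathbf{Top}_0$ of $T_0$ topological spaces and continuous maps, is simple.
   Context: An $\mathbf{Ord}$-category is a locally small category whose hom-sets are posets and whose composition is monotone in each variable; an $\mathbf{Ord}$-monad is a monad whose functor part is monotone on hom-posets. Each $T_0$ space $X$ is ordered by $x\le y$ iff $y\in\overline{\{x\}}$ (the opposite of the specialisation order), and $\mathbf{Top}_0$ is an $\mathbf{Ord}$-category with $f\le g$ iff $f(x)\le g(x)$ for all $x$. The comma-object $f\downarrow g$ of $f\colon X\to Z\leftarrow Y\colon g$ in $\mathbf{Top}_0$ is the subspace $\{(x,y):f(x)\le g(y)\}$ of $X\times Y$. The filter monad $\mathsf{F}=(F,\eta,\mu)$: $FX$ is the set of all filters of open sets of $X$, with topology generated by the sets $U^{\#}=\{\varphi\in FX:U\in\varphi\}$, $U$ open in $X$ (so $\varphi\le\psi$ in $FX$ iff $\varphi\supseteq\psi$); $Ff(\varphi)=\{V\in\mathcal{O}(Y):f^{-1}(V)\in\varphi\}$; $\eta_X(x)=\{U\in\mathcal{O}(X):x\in U\}$; $\mu_X(\Theta)=\{U\in\mathcal{O}(X):U^{\#}\in\Theta\}$. This monad is lax idempotent ($F\eta\le\eta F$). For an $\mathbf{Ord}$-monad $\mathsf{T}=(T,\eta,\mu)$ and $f\colon X\to Y$, let $Kf=Tf\downarrow\eta_Y$ be the comma-object of $Tf\colon TX\to TY$ and $\eta_Y\colon Y\to TY$, with projections $q_f\colon Kf\to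 TX$, $Rf\colon Kf\to Y$, and $Lf\colon X\to Kf$ the unique morphism with $q_f\cdot Lf=\eta_X$, $Rf\cdot Lf=f$. $\mathsf{T}$ is simple if for every $f\colon X\to Y$ the inequality $T(Lf)\cdot\mu_X\cdot Tq_f\le1_{TKf}$ holds (equivalently, the adjunction $F^{\mathsf T}Lf\dashv\varepsilon_{F^{\mathsf T}X}\cdot F^{\mathsf T}q_f$ holds in $\mathsf{T}\text{-Alg}$, where $F^{\mathsf{T}}$ is the free algebra functor and $\varepsilon$ the counit of the free algebra adjunction). *)

theory Defs
  imports "HOL-Analysis.Analysis"
begin

section \<open>The \<open>Ord\<close>-category of T0 spaces\<close>

text \<open>
  Objects are topologies satisfying \<^const>\<open>t0_space\<close>, on arbitrary types; morphisms \<open>X \<rightarrow> Y\<close> are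
  functions satisfying \<^term>\<open>continuous_map X Y\<close>, of which only the values on \<^term>\<open>topspace X\<close> are
  meaningful. There is no HOL type containing all these objects, and \<open>FX\<close> lives on another type than
  \<open>X\<close>. The filter monad is therefore given by polymorphic constants, whose functor, naturality and
  monad laws are proved below.
\<close>

text \<open>This is the opposite of the specialisation order.\<close>

definition space_le :: "'a topology \<Rightarrow> 'a \<Rightarrow> 'a \<Rightarrow> bool" where
  "space_le X x y \<longleftrightarrow> x \<in> topspace X \<and> y \<in> X closure_of {x}"

definition hom_le :: "'a topology \<Rightarrow> 'b topology \<Rightarrow> ('a \<Rightarrow> 'b) \<Rightarrow> ('a \<Rightarrow> 'b) \<Rightarrow> bool" where
  "hom_le X Y f g \<longleftrightarrow> (\<forall>x\<in>topspace X. space_le Y (f x) (g x))"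

text \<open>The comma-object \<open>f \<down> g\<close> of \<open>f : X \<rightarrow> Z \<leftarrow> Y : g\<close>; its projections are
  \<^const>\<open>fst\<close> and \<^const>\<open>snd\<close>.\<close>

definition comma ::
  "'a topology \<Rightarrow> 'b topology \<Rightarrow> 'c topology \<Rightarrow> ('a \<Rightarrow> 'c) \<Rightarrow> ('b \<Rightarrow> 'c) \<Rightarrow> ('a \<times> 'b) topology" where
  "comma X Y Z f g = subtopology (prod_topology X Y) {(x, y). space_le Z (f x) (g y)}"

lemma space_le_iff:
  "space_le X x y \<longleftrightarrow>
     x \<in> topspace X \<and> y \<in> topspace X \<and> (\<forall>U. openin X U \<and> y \<in> U \<longrightarrow> x \<in> U)"
  by (auto simp: space_le_def in_closure_of)

lemma space_le_refl: "x \<in> topspace X \<Longrightarrow> space_le X x x"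
  by (auto simp: space_le_iff)

lemma space_le_trans: "space_le X x y \<Longrightarrow> space_le X y z \<Longrightarrow> space_le X x z"
  by (auto simp: space_le_iff)

lemma space_le_antisym: "t0_space X \<Longrightarrow> space_le X x y \<Longrightarrow> space_le X y x \<Longrightarrow> x = y"
  unfolding space_le_iff t0_space_def by meson

lemma space_le_continuous_map:
  assumes f: "continuous_map X Y f" and le: "space_le X x y"
  shows "space_le Y (f x) (f y)"
  unfolding space_le_iff
proof (intro conjI allI impI)
  show "f x \<in> topspace Y" "f y \<in> topspace Y"
    using f le by (auto simp: continuous_map_def space_le_iff)
  fix V assume V: "openin Y V \<and> f y \<in> V"
  then have "openin X {z \<in> topspace X. f z \<in> V}" using f by (simp add: continuous_map_def)
  moreover have "y \<in> {z \<in> topspace X. f z \<in> V}" using V le by (simp add: space_le_iff)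
  ultimately have "x \<in> {z \<in> topspace X. f z \<in> V}" using le unfolding space_le_iff by meson
  then show "f x \<in> V" by simp
qed

lemma hom_le_comp:
  assumes "continuous_map X Y f" "continuous_map X Y f'"
    and "continuous_map Y Z g" "continuous_map Y Z g'"
    and "hom_le X Y f f'" "hom_le Y Z g g'"
  shows "hom_le X Z (g \<circ> f) (g' \<circ> f')"
  unfolding hom_le_def comp_apply
proof
  fix x assume x: "x \<in> topspace X"
  then have "space_le Z (g (f x)) (g (f' x))"
    using space_le_continuous_map[OF assms(3)] assms(5) by (simp add: hom_le_def)
  moreover have "f' x \<in> topspace Y"
    using x assms(2) by (auto simp: continuous_map_def)
  then have "space_le Z (g (f' x)) (g' (f' x))"
    using assms(6) by (simp add: hom_le_def)
  ultimately show "space_le Z (g (f x)) (g' (f' x))"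
    by (rule space_le_trans)
qed

lemma topspace_comma:
  "topspace (comma X Y Z f g) =
     {(x, y). x \<in> topspace X \<and> y \<in> topspace Y \<and> space_le Z (f x) (g y)}"
  by (auto simp: comma_def)

lemma t0_space_comma: "t0_space X \<Longrightarrow> t0_space Y \<Longrightarrow> t0_space (comma X Y Z f g)"
  unfolding comma_def by (intro t0_space_subtopology) (simp add: t0_space_prod_topology_iff)

lemma continuous_map_comma_fst: "continuous_map (comma X Y Z f g) X fst"
  by (simp add: comma_def continuous_map_from_subtopology continuous_map_fst)

lemma continuous_map_comma_snd: "continuous_map (comma X Y Z f g) Y snd"
  by (simp add: comma_def continuous_map_from_subtopology continuous_map_snd)

lemma hom_le_comma: "hom_le (comma X Y Z f g) Z (f \<circ> fst) (g \<circ> snd)"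
  by (auto simp: hom_le_def topspace_comma)

lemma continuous_map_into_comma_iff:
  "continuous_map W (comma X Y Z f g) h \<longleftrightarrow>
     continuous_map W X (fst \<circ> h) \<and> continuous_map W Y (snd \<circ> h) \<and>
     hom_le W Z (f \<circ> (fst \<circ> h)) (g \<circ> (snd \<circ> h))"
  unfolding comma_def continuous_map_in_subtopology continuous_map_pairwise hom_le_def
  by (auto simp: split_beta Pi_iff)

lemma hom_le_into_comma_iff:
  assumes "continuous_map W (comma X Y Z f g) h" "continuous_map W (comma X Y Z f g) k"
  shows "hom_le W (comma X Y Z f g) h k \<longleftrightarrow>
    hom_le W X (fst \<circ> h) (fst \<circ> k) \<and> hom_le W Y (snd \<circ> h) (snd \<circ> k)"
proof -
  have prod: "space_le (prod_topology X Y) p q \<longleftrightarrow>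
      space_le X (fst p) (fst q) \<and> space_le Y (snd p) (snd q)" for p q
  proof -
    have "{p} = {fst p} \<times> {snd p}" by auto
    then show ?thesis
      unfolding space_le_def by (metis closure_of_Times mem_Times_iff topspace_prod_topology)
  qed
  have sub: "space_le (subtopology T S) p q \<longleftrightarrow> space_le T p q" if "p \<in> S" "q \<in> S"
    for T :: "('b \<times> 'c) topology" and S p q
    using that by (auto simp: space_le_iff openin_subtopology)
  have hk: "h \<in> topspace W \<rightarrow> {(x, y). space_le Z (f x) (g y)}"
      "k \<in> topspace W \<rightarrow> {(x, y). space_le Z (f x) (g y)}"
    using assms unfolding comma_def continuous_map_in_subtopology by simp_all
  have "space_le (comma X Y Z f g) (h w) (k w) \<longleftrightarrow>
      space_le X (fst (h w)) (fst (k w)) \<and> space_le Y (snd (h w)) (snd (k w))"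
    if "w \<in> topspace W" for w
    unfolding comma_def sub[OF Pi_mem[OF hk(1) that] Pi_mem[OF hk(2) that]] prod ..
  then show ?thesis
    unfolding hom_le_def by auto
qed

section \<open>The filter monad\<close>

text \<open>The improper filter, the one containing the empty set, is allowed.\<close>

definition open_filter :: "'a topology \<Rightarrow> 'a set set \<Rightarrow> bool" where
  "open_filter X \<phi> \<longleftrightarrow>
     (\<forall>U\<in>\<phi>. openin X U) \<and>
     topspace X \<in> \<phi> \<and>
     (\<forall>U\<in>\<phi>. \<forall>V\<in>\<phi>. U \<inter> V \<in> \<phi>) \<and>
     (\<forall>U\<in>\<phi>. \<forall>V. openin X V \<and> U \<subseteq> V \<longrightarrow> V \<in> \<phi>)"

definition sharp :: "'a topology \<Rightarrow> 'a set \<Rightarrow> 'a set set set" where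
  "sharp X U = {\<phi>. open_filter X \<phi> \<and> U \<in> \<phi>}"

definition filter_space :: "'a topology \<Rightarrow> 'a set set topology" where
  "filter_space X = topology_generated_by {sharp X U |U. openin X U}"

definition filter_map ::
  "'a topology \<Rightarrow> 'b topology \<Rightarrow> ('a \<Rightarrow> 'b) \<Rightarrow> 'a set set \<Rightarrow> 'b set set" where
  "filter_map X Y f \<phi> = {V. openin Y V \<and> {x \<in> topspace X. f x \<in> V} \<in> \<phi>}"

definition filter_unit :: "'a topology \<Rightarrow> 'a \<Rightarrow> 'a set set" where
  "filter_unit X x = {U. openin X U \<and> x \<in> U}"

definition filter_mult :: "'a topology \<Rightarrow> 'a set set set set \<Rightarrow> 'a set set" where
  "filter_mult X \<Theta> = {U. openin X U \<and> sharp X U \<in> \<Theta>}"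

lemma open_filter_openin: "open_filter X \<phi> \<Longrightarrow> U \<in> \<phi> \<Longrightarrow> openin X U"
  unfolding open_filter_def by blast

lemma open_filter_topspace: "open_filter X \<phi> \<Longrightarrow> topspace X \<in> \<phi>"
  unfolding open_filter_def by blast

lemma open_filter_Int: "open_filter X \<phi> \<Longrightarrow> U \<in> \<phi> \<Longrightarrow> V \<in> \<phi> \<Longrightarrow> U \<inter> V \<in> \<phi>"
  unfolding open_filter_def by blast

lemma open_filter_mono:
  "open_filter X \<phi> \<Longrightarrow> U \<in> \<phi> \<Longrightarrow> openin X V \<Longrightarrow> U \<subseteq> V \<Longrightarrow> V \<in> \<phi>"
  unfolding open_filter_def by blast

lemma sharp_topspace: "sharp X (topspace X) = {\<phi>. open_filter X \<phi>}"
  by (auto simp: sharp_def open_filter_def)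

lemma topspace_filter_space: "topspace (filter_space X) = {\<phi>. open_filter X \<phi>}"
  unfolding filter_space_def topology_generated_by_topspace
  using sharp_topspace[of X] by (auto simp: sharp_def)

lemma openin_sharp: "openin X U \<Longrightarrow> openin (filter_space X) (sharp X U)"
  unfolding filter_space_def by (rule topology_generated_by_Basis) blast

lemma sharp_Int:
  "openin X U \<Longrightarrow> openin X V \<Longrightarrow> sharp X (U \<inter> V) = sharp X U \<inter> sharp X V"
  unfolding sharp_def open_filter_def by blast

lemma sharp_mono: "openin X V \<Longrightarrow> U \<subseteq> V \<Longrightarrow> sharp X U \<subseteq> sharp X V"
  unfolding sharp_def open_filter_def by blast

lemma space_le_filter_space:
  "space_le (filter_space X) \<phi> \<psi> \<longleftrightarrow> open_filter X \<phi> \<and> open_filter X \<psi> \<and> \<psi> \<subseteq> \<phi>"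
proof
  assume le: "space_le (filter_space X) \<phi> \<psi>"
  then have fil: "open_filter X \<phi>" "open_filter X \<psi>"
    by (auto simp: space_le_iff topspace_filter_space)
  have "U \<in> \<phi>" if "U \<in> \<psi>" for U
  proof -
    have "openin X U" "\<psi> \<in> sharp X U"
      using that fil open_filter_openin by (auto simp: sharp_def)
    then have "\<phi> \<in> sharp X U" using le openin_sharp unfolding space_le_iff by blast
    then show ?thesis by (simp add: sharp_def)
  qed
  with fil show "open_filter X \<phi> \<and> open_filter X \<psi> \<and> \<psi> \<subseteq> \<phi>" by blast
next
  assume fil: "open_filter X \<phi> \<and> open_filter X \<psi> \<and> \<psi> \<subseteq> \<phi>"
  have "\<phi> \<in> S" if "generate_topology_on {sharp X U |U. openin X U} S" "\<psi> \<in> S" for S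
    using that by induction (use fil in \<open>auto simp: sharp_def\<close>)
  then show "space_le (filter_space X) \<phi> \<psi>"
    using fil unfolding space_le_iff topspace_filter_space
    by (auto simp: filter_space_def openin_topology_generated_by_iff)
qed

lemma t0_space_filter_space: "t0_space (filter_space X)"
  unfolding t0_space_def
proof (intro ballI impI)
  fix \<phi> \<psi> assume "\<phi> \<in> topspace (filter_space X)" "\<psi> \<in> topspace (filter_space X)" "\<phi> \<noteq> \<psi>"
  then have fil: "open_filter X \<phi>" "open_filter X \<psi>" and "\<phi> \<noteq> \<psi>"
    by (simp_all add: topspace_filter_space)
  then obtain U where U: "(U \<in> \<phi>) \<noteq> (U \<in> \<psi>)" by (meson set_eqI)
  then have "openin X U" using fil unfolding open_filter_def by meson
  moreover have "(\<phi> \<notin> sharp X U) = (\<psi> \<in> sharp X U)" using U fil by (simp add: sharp_def)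
  ultimately show "\<exists>U. openin (filter_space X) U \<and> (\<phi> \<notin> U) = (\<psi> \<in> U)"
    using openin_sharp by meson
qed

lemma continuous_map_into_filter_space:
  assumes "\<And>x. x \<in> topspace X \<Longrightarrow> open_filter Y (h x)"
    and "\<And>U. openin Y U \<Longrightarrow> openin X {x \<in> topspace X. U \<in> h x}"
  shows "continuous_map X (filter_space Y) h"
  unfolding filter_space_def
proof (rule continuous_on_generated_topo)
  fix S assume "S \<in> {sharp Y U |U. openin Y U}"
  then obtain U where U: "openin Y U" "S = sharp Y U" by blast
  have "h -` S \<inter> topspace X = {x \<in> topspace X. U \<in> h x}"
    using assms(1) U by (auto simp: sharp_def)
  then show "openin X (h -` S \<inter> topspace X)" using assms(2) U by simp
next
  show "h ` topspace X \<subseteq> \<Union> {sharp Y U |U. openin Y U}"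
    using assms(1) sharp_topspace[of Y] by blast
qed

lemma open_filter_filter_map:
  assumes f: "continuous_map X Y f" and \<phi>: "open_filter X \<phi>"
  shows "open_filter Y (filter_map X Y f \<phi>)"
proof -
  have pre: "openin X {x \<in> topspace X. f x \<in> V}" if "openin Y V" for V
    using f that by (simp add: continuous_map_def)
  show ?thesis
    unfolding open_filter_def
  proof (intro conjI ballI allI impI)
    have "{x \<in> topspace X. f x \<in> topspace Y} = topspace X"
      using f by (auto simp: continuous_map_def)
    then show "topspace Y \<in> filter_map X Y f \<phi>"
      using open_filter_topspace[OF \<phi>] by (simp add: filter_map_def)
  next
    fix U V assume "U \<in> filter_map X Y f \<phi>" "V \<in> filter_map X Y f \<phi>"
    moreover have "{x \<in> topspace X. f x \<in> U \<inter> V} =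
        {x \<in> topspace X. f x \<in> U} \<inter> {x \<in> topspace X. f x \<in> V}"
      by blast
    ultimately show "U \<inter> V \<in> filter_map X Y f \<phi>"
      using open_filter_Int[OF \<phi>] by (simp add: filter_map_def openin_Int)
  next
    fix U V assume "U \<in> filter_map X Y f \<phi>" and V: "openin Y V \<and> U \<subseteq> V"
    moreover have "{x \<in> topspace X. f x \<in> U} \<subseteq> {x \<in> topspace X. f x \<in> V}"
      using V by blast
    ultimately show "V \<in> filter_map X Y f \<phi>"
      using open_filter_mono[OF \<phi>] pre[of V] by (auto simp: filter_map_def)
  qed (simp add: filter_map_def)
qed

lemma continuous_map_filter_map:
  assumes f: "continuous_map X Y f"
  shows "continuous_map (filter_space X) (filter_space Y) (filter_map X Y f)"
proof (rule continuous_map_into_filter_space)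
  show "open_filter Y (filter_map X Y f \<phi>)" if "\<phi> \<in> topspace (filter_space X)" for \<phi>
    using that open_filter_filter_map[OF f] by (simp add: topspace_filter_space)
  fix V assume V: "openin Y V"
  have "{\<phi> \<in> topspace (filter_space X). V \<in> filter_map X Y f \<phi>} =
      sharp X {x \<in> topspace X. f x \<in> V}"
    using V by (auto simp: topspace_filter_space filter_map_def sharp_def)
  moreover have "openin X {x \<in> topspace X. f x \<in> V}"
    using f V by (simp add: continuous_map_def)
  ultimately show "openin (filter_space X) {\<phi> \<in> topspace (filter_space X). V \<in> filter_map X Y f \<phi>}"
    by (simp add: openin_sharp)
qed

lemma filter_map_id:
  assumes "\<phi> \<in> topspace (filter_space X)"
  shows "filter_map X X id \<phi> = \<phi>"
proof -
  have "{x \<in> topspace X. x \<in> V} = V" if "openin X V" for V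
    using openin_subset[OF that] by blast
  moreover have "openin X V" if "V \<in> \<phi>" for V
    using assms that open_filter_openin by (simp add: topspace_filter_space)
  ultimately show ?thesis
    by (auto simp: filter_map_def)
qed

lemma filter_map_comp:
  assumes "continuous_map X Y f" "continuous_map Y Z g"
  shows "filter_map X Z (g \<circ> f) \<phi> = filter_map Y Z g (filter_map X Y f \<phi>)"
proof -
  have "{x \<in> topspace X. f x \<in> {y \<in> topspace Y. g y \<in> V}} = {x \<in> topspace X. (g \<circ> f) x \<in> V}" for V
    using assms by (auto simp: continuous_map_def)
  then show ?thesis
    using assms(2) by (auto simp: filter_map_def continuous_map_def)
qed

lemma filter_map_cong:
  "(\<And>x. x \<in> topspace X \<Longrightarrow> f x = g x) \<Longrightarrow> filter_map X Y f = filter_map X Y g"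
  by (simp add: filter_map_def fun_eq_iff cong: conj_cong)

lemma filter_map_mono:
  assumes "continuous_map X Y f" "continuous_map X Y g" "hom_le X Y f g"
  shows "hom_le (filter_space X) (filter_space Y) (filter_map X Y f) (filter_map X Y g)"
proof -
  have sub: "{x \<in> topspace X. g x \<in> V} \<subseteq> {x \<in> topspace X. f x \<in> V}" if "openin Y V" for V
    using assms(3) that by (auto simp: hom_le_def space_le_iff)
  have op: "openin X {x \<in> topspace X. f x \<in> V}" if "openin Y V" for V
    using assms(1) that by (simp add: continuous_map_def)
  show ?thesis
    unfolding hom_le_def space_le_filter_space topspace_filter_space
  proof (intro ballI conjI subsetI)
    fix \<phi> V assume \<phi>: "\<phi> \<in> {\<phi>. open_filter X \<phi>}" and "V \<in> filter_map X Y g \<phi>"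
    then have V: "openin Y V" "{x \<in> topspace X. g x \<in> V} \<in> \<phi>"
      by (auto simp: filter_map_def)
    then have "{x \<in> topspace X. f x \<in> V} \<in> \<phi>"
      using \<phi> sub[OF V(1)] op[OF V(1)] open_filter_mono by blast
    then show "V \<in> filter_map X Y f \<phi>" using V by (simp add: filter_map_def)
  qed (simp_all add: open_filter_filter_map[OF assms(1)] open_filter_filter_map[OF assms(2)])
qed

lemma open_filter_filter_unit: "x \<in> topspace X \<Longrightarrow> open_filter X (filter_unit X x)"
  by (auto simp: open_filter_def filter_unit_def)

lemma continuous_map_filter_unit: "continuous_map X (filter_space X) (filter_unit X)"
proof (rule continuous_map_into_filter_space)
  fix U assume U: "openin X U"
  have "{x \<in> topspace X. U \<in> filter_unit X x} = U"
    using U openin_subset[OF U] by (auto simp: filter_unit_def)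
  with U show "openin X {x \<in> topspace X. U \<in> filter_unit X x}" by simp
qed (rule open_filter_filter_unit)

lemma filter_unit_natural:
  assumes "continuous_map X Y f" "x \<in> topspace X"
  shows "filter_map X Y f (filter_unit X x) = filter_unit Y (f x)"
  using assms by (auto simp: filter_map_def filter_unit_def continuous_map_def)

lemma open_filter_filter_mult:
  assumes \<Theta>: "open_filter (filter_space X) \<Theta>"
  shows "open_filter X (filter_mult X \<Theta>)"
  unfolding open_filter_def
proof (intro conjI ballI allI impI)
  show "topspace X \<in> filter_mult X \<Theta>"
    using open_filter_topspace[OF \<Theta>]
    by (simp add: filter_mult_def sharp_topspace topspace_filter_space)
  show "U \<inter> V \<in> filter_mult X \<Theta>" if "U \<in> filter_mult X \<Theta>" "V \<in> filter_mult X \<Theta>" for U V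
    using that open_filter_Int[OF \<Theta>] by (simp add: filter_mult_def sharp_Int openin_Int)
  show "V \<in> filter_mult X \<Theta>" if "U \<in> filter_mult X \<Theta>" "openin X V \<and> U \<subseteq> V" for U V
    using that open_filter_mono[OF \<Theta>] sharp_mono[of X V U] openin_sharp[of X V]
    by (auto simp: filter_mult_def)
qed (simp add: filter_mult_def)

lemma continuous_map_filter_mult:
  "continuous_map (filter_space (filter_space X)) (filter_space X) (filter_mult X)"
proof (rule continuous_map_into_filter_space)
  show "open_filter X (filter_mult X \<Theta>)" if "\<Theta> \<in> topspace (filter_space (filter_space X))" for \<Theta>
    using that open_filter_filter_mult by (simp add: topspace_filter_space)
  fix U assume "openin X U"
  moreover from this have "{\<Theta> \<in> topspace (filter_space (filter_space X)). U \<in> filter_mult X \<Theta>} =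
      sharp (filter_space X) (sharp X U)"
    by (auto simp: topspace_filter_space filter_mult_def sharp_def[of "filter_space X"])
  ultimately show "openin (filter_space (filter_space X))
      {\<Theta> \<in> topspace (filter_space (filter_space X)). U \<in> filter_mult X \<Theta>}"
    by (simp add: openin_sharp)
qed

lemma filter_map_preimage_sharp:
  assumes "continuous_map X Y f" "openin Y V"
  shows "{\<phi> \<in> topspace (filter_space X). filter_map X Y f \<phi> \<in> sharp Y V} =
    sharp X {x \<in> topspace X. f x \<in> V}"
  using assms open_filter_filter_map[OF assms(1)]
  by (auto simp: topspace_filter_space filter_map_def sharp_def)

lemma filter_mult_natural:
  assumes f: "continuous_map X Y f"
  shows "filter_mult Y (filter_map (filter_space X) (filter_space Y) (filter_map X Y f) \<Theta>) =
    filter_map X Y f (filter_mult X \<Theta>)"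
proof -
  have "openin X {x \<in> topspace X. f x \<in> V}" if "openin Y V" for V
    using f that by (simp add: continuous_map_def)
  then have "V \<in> filter_mult Y (filter_map (filter_space X) (filter_space Y) (filter_map X Y f) \<Theta>) \<longleftrightarrow>
      V \<in> filter_map X Y f (filter_mult X \<Theta>)" for V
    unfolding filter_mult_def filter_map_def[of "filter_space X"]
      filter_map_def[of X Y f "Collect _"] mem_Collect_eq
    using filter_map_preimage_sharp[OF f, of V] openin_sharp[of Y V] by auto
  then show ?thesis by blast
qed

lemma filter_unit_preimage_sharp:
  assumes U: "openin X U"
  shows "{x \<in> topspace X. filter_unit X x \<in> sharp X U} = U"
  using U openin_subset[OF U] open_filter_filter_unit[of _ X]
  by (auto simp: sharp_def filter_unit_def[of X])

lemma filter_mult_unit: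
  assumes "\<phi> \<in> topspace (filter_space X)"
  shows "filter_mult X (filter_unit (filter_space X) \<phi>) = \<phi>"
proof -
  have fil: "open_filter X \<phi>" using assms by (simp add: topspace_filter_space)
  then have "\<phi> \<in> sharp X U \<longleftrightarrow> U \<in> \<phi>" for U by (simp add: sharp_def)
  with fil show ?thesis
    using open_filter_openin by (auto simp: filter_mult_def filter_unit_def openin_sharp)
qed

lemma filter_mult_map_unit:
  assumes "\<phi> \<in> topspace (filter_space X)"
  shows "filter_mult X (filter_map X (filter_space X) (filter_unit X) \<phi>) = \<phi>"
  using assms open_filter_openin by (auto simp: filter_mult_def filter_map_def openin_sharp
      filter_unit_preimage_sharp topspace_filter_space)

lemma filter_mult_preimage_sharp:
  assumes "openin X U"
  shows "{\<Theta> \<in> topspace (filter_space (filter_space X)). filter_mult X \<Theta> \<in> sharp X U} =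
    sharp (filter_space X) (sharp X U)"
proof -
  have "filter_mult X \<Theta> \<in> sharp X U \<longleftrightarrow> sharp X U \<in> \<Theta>" if "open_filter (filter_space X) \<Theta>" for \<Theta>
  proof -
    have "filter_mult X \<Theta> \<in> sharp X U \<longleftrightarrow> U \<in> filter_mult X \<Theta>"
      using open_filter_filter_mult[OF that] by (simp add: sharp_def)
    then show ?thesis using assms by (simp add: filter_mult_def)
  qed
  then show ?thesis
    by (auto simp: topspace_filter_space sharp_def[of "filter_space X"])
qed

lemma filter_mult_assoc:
  "filter_mult X (filter_mult (filter_space X) \<Theta>) =
   filter_mult X (filter_map (filter_space (filter_space X)) (filter_space X) (filter_mult X) \<Theta>)"
proof -
  have "U \<in> filter_mult X (filter_mult (filter_space X) \<Theta>) \<longleftrightarrow>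
    U \<in> filter_mult X
      (filter_map (filter_space (filter_space X)) (filter_space X) (filter_mult X) \<Theta>)" for U
  proof (cases "openin X U")
    case True
    have "U \<in> filter_mult X \<Psi> \<longleftrightarrow> sharp X U \<in> \<Psi>" for \<Psi>
      using True by (simp add: filter_mult_def)
    then show ?thesis
      using True by (simp add: filter_mult_def[of "filter_space X"] filter_map_def
          filter_mult_preimage_sharp openin_sharp)
  qed (simp add: filter_mult_def)
  then show ?thesis by blast
qed

lemma filter_monad_lax_idempotent:
  "hom_le (filter_space X) (filter_space (filter_space X))
     (filter_map X (filter_space X) (filter_unit X)) (filter_unit (filter_space X))"
  unfolding hom_le_def space_le_filter_space
proof (intro ballI conjI subsetI)
  fix \<phi> S assume \<phi>: "\<phi> \<in> topspace (filter_space X)" and S: "S \<in> filter_unit (filter_space X) \<phi>"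
  have fil: "open_filter X \<phi>" using \<phi> by (simp add: topspace_filter_space)
  have "{x \<in> topspace X. filter_unit X x \<in> S} \<in> \<phi>"
    if "generate_topology_on {sharp X U |U. openin X U} S" "\<phi> \<in> S" for S
    using that
  proof induction
    case (Int a b)
    then have "{x \<in> topspace X. filter_unit X x \<in> a} \<inter> {x \<in> topspace X. filter_unit X x \<in> b} \<in> \<phi>"
      using fil unfolding open_filter_def by blast
    moreover have "{x \<in> topspace X. filter_unit X x \<in> a \<inter> b} =
        {x \<in> topspace X. filter_unit X x \<in> a} \<inter> {x \<in> topspace X. filter_unit X x \<in> b}"
      by blast
    ultimately show ?case by simp
  next
    case (UN K)
    then obtain k where k: "k \<in> K" "\<phi> \<in> k" by blast
    have "generate_topology_on {sharp X U |U. openin X U} (\<Union> K)"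
      using UN by (blast intro: generate_topology_on.UN)
    then have "openin X {x \<in> topspace X. filter_unit X x \<in> \<Union> K}"
      using continuous_map_filter_unit[of X]
      by (simp add: continuous_map_def filter_space_def openin_topology_generated_by_iff del: Union_iff)
    moreover have "{x \<in> topspace X. filter_unit X x \<in> k} \<subseteq> {x \<in> topspace X. filter_unit X x \<in> \<Union> K}"
      using k by blast
    ultimately show ?case using UN k fil unfolding open_filter_def by blast
  next
    case (Basis s)
    then obtain U where "openin X U" "s = sharp X U" by blast
    with Basis show ?case by (simp add: filter_unit_preimage_sharp) (simp add: sharp_def)
  qed auto
  then show "S \<in> filter_map X (filter_space X) (filter_unit X) \<phi>"
    using S unfolding filter_unit_def[of "filter_space X"] filter_map_def
    by (simp add: filter_space_def openin_topology_generated_by_iff)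
next
  fix \<phi> assume "\<phi> \<in> topspace (filter_space X)"
  then show "open_filter (filter_space X) (filter_map X (filter_space X) (filter_unit X) \<phi>)"
    by (intro open_filter_filter_map continuous_map_filter_unit) (simp add: topspace_filter_space)
qed (rule open_filter_filter_unit)

section \<open>The factorisation \<open>f = Rf \<cdot> Lf\<close>\<close>

text \<open>\<open>Kf = Ff \<down> \<eta>\<^sub>Y\<close>, with \<open>q\<^sub>f\<close> and \<open>Rf\<close> the two projections.\<close>

definition filter_K :: "'a topology \<Rightarrow> 'b topology \<Rightarrow> ('a \<Rightarrow> 'b) \<Rightarrow> ('a set set \<times> 'b) topology" where
  "filter_K X Y f =
     comma (filter_space X) Y (filter_space Y) (filter_map X Y f) (filter_unit Y)"

definition filter_q :: "'a set set \<times> 'b \<Rightarrow> 'a set set" where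
  "filter_q = fst"

definition filter_R :: "'a set set \<times> 'b \<Rightarrow> 'b" where
  "filter_R = snd"

definition filter_L :: "'a topology \<Rightarrow> ('a \<Rightarrow> 'b) \<Rightarrow> 'a \<Rightarrow> 'a set set \<times> 'b" where
  "filter_L X f x = (filter_unit X x, f x)"

lemma t0_space_filter_K: "t0_space Y \<Longrightarrow> t0_space (filter_K X Y f)"
  by (simp add: filter_K_def t0_space_comma t0_space_filter_space)

lemma continuous_map_filter_q: "continuous_map (filter_K X Y f) (filter_space X) filter_q"
  by (simp add: filter_K_def filter_q_def continuous_map_comma_fst)

lemma continuous_map_filter_R: "continuous_map (filter_K X Y f) Y filter_R"
  by (simp add: filter_K_def filter_R_def continuous_map_comma_snd)

lemma filter_q_L: "filter_q \<circ> filter_L X f = filter_unit X"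
  by (auto simp: filter_q_def filter_L_def)

lemma filter_R_L: "filter_R \<circ> filter_L X f = f"
  by (auto simp: filter_R_def filter_L_def)

lemma continuous_map_filter_L:
  assumes f: "continuous_map X Y f"
  shows "continuous_map X (filter_K X Y f) (filter_L X f)"
proof -
  have "hom_le X (filter_space Y) (filter_map X Y f \<circ> filter_unit X) (filter_unit Y \<circ> f)"
    using f filter_unit_natural[OF f] open_filter_filter_unit[of _ Y]
    by (auto simp: hom_le_def space_le_filter_space continuous_map_def)
  then show ?thesis
    using f continuous_map_filter_unit filter_q_L[of X f] filter_R_L[of X f]
    by (simp add: filter_K_def continuous_map_into_comma_iff filter_q_def filter_R_def)
qed

lemma filter_L_unique:
  assumes "\<And>x. x \<in> topspace X \<Longrightarrow> filter_q (h x) = filter_unit X x"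
    and "\<And>x. x \<in> topspace X \<Longrightarrow> filter_R (h x) = f x"
    and "x \<in> topspace X"
  shows "h x = filter_L X f x"
  using assms by (simp add: filter_L_def filter_q_def filter_R_def prod_eq_iff)

end

theory Submission
  imports Defs
begin

text \<open>
  Unfolding the monad structure, the inequality says that every open \<open>W \<in> \<Theta>\<close> satisfies
  \<open>q\<^sub>f\<^sup>-\<^sup>1((Lf\<^sup>-\<^sup>1 W)\<^sup>#) \<in> \<Theta>\<close>, so it suffices that \<open>Lf\<^sup>-\<^sup>1 W \<in> \<phi>\<close> for all \<open>(\<phi>, y) \<in> W\<close>.
  Choose a basic neighbourhood \<open>A \<times> B\<close> of \<open>(\<phi>, y)\<close> whose trace on \<open>Kf\<close> lies in \<open>W\<close>. Then
  \<open>\<eta>\<^sup>-\<^sup>1 A \<in> \<phi>\<close> because the monad is lax idempotent, \<open>f\<^sup>-\<^sup>1 B \<in> \<phi>\<close> because \<open>Ff(\<phi>) \<le> \<eta>(y)\<close>,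
  and \<open>\<eta>\<^sup>-\<^sup>1 A \<inter> f\<^sup>-\<^sup>1 B \<subseteq> Lf\<^sup>-\<^sup>1 W\<close>.
\<close>

text \<open>Lax idempotency at \<open>\<phi>\<close>: the order of \<open>filter_space\<close> is
  reverse inclusion, so F\<eta> \<le> \<eta>F says that every open neighbourhood of
  \<open>\<phi>\<close> belongs to the filter F\<eta>(\<open>\<phi>\<close>).\<close>

lemma filter_unit_preimage_mem:
  assumes "open_filter X \<phi>" "openin (filter_space X) A" "\<phi> \<in> A"
  shows "{x \<in> topspace X. filter_unit X x \<in> A} \<in> \<phi>"
proof -
  have "A \<in> filter_unit (filter_space X) \<phi>"
    using assms by (simp add: filter_unit_def)
  moreover have "filter_unit (filter_space X) \<phi> \<subseteq> filter_map X (filter_space X) (filter_unit X) \<phi>"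
    using filter_monad_lax_idempotent[of X] assms(1)
    by (simp add: hom_le_def space_le_filter_space topspace_filter_space)
  ultimately show ?thesis
    by (auto simp: filter_map_def)
qed

lemma filter_L_preimage_mem:
  assumes f: "continuous_map X Y f"
    and W: "openin (filter_K X Y f) W" and mem: "(\<phi>, y) \<in> W"
  shows "{x \<in> topspace X. filter_L X f x \<in> W} \<in> \<phi>"
proof -
  have K: "(\<phi>, y) \<in> topspace (filter_K X Y f)"
    using openin_subset[OF W] mem by blast
  then have fil: "open_filter X \<phi>"
    and le: "filter_unit Y y \<subseteq> filter_map X Y f \<phi>"
    by (auto simp: filter_K_def topspace_comma topspace_filter_space space_le_filter_space)
  obtain T where T: "openin (prod_topology (filter_space X) Y) T"
    and WT: "W = T \<inter> {(\<phi>, y). space_le (filter_space Y) (filter_map X Y f \<phi>) (filter_unit Y y)}"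
    using W unfolding filter_K_def comma_def openin_subtopology by blast
  obtain A B where A: "openin (filter_space X) A" "\<phi> \<in> A"
    and B: "openin Y B" "y \<in> B" and AB: "A \<times> B \<subseteq> T"
    using T mem unfolding WT openin_prod_topology_alt by blast
  have "{x \<in> topspace X. filter_unit X x \<in> A} \<in> \<phi>"
    using fil A by (rule filter_unit_preimage_mem)
  moreover have "{x \<in> topspace X. f x \<in> B} \<in> \<phi>"
    using le B by (auto simp: filter_unit_def filter_map_def)
  ultimately have "{x \<in> topspace X. filter_unit X x \<in> A} \<inter> {x \<in> topspace X. f x \<in> B} \<in> \<phi>"
    by (rule open_filter_Int[OF fil])
  moreover have L: "continuous_map X (filter_K X Y f) (filter_L X f)"
    using f by (rule continuous_map_filter_L)
  have "openin X {x \<in> topspace X. filter_L X f x \<in> W}"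
    using L W by (rule openin_continuous_map_preimage)
  moreover have "{x \<in> topspace X. filter_unit X x \<in> A} \<inter> {x \<in> topspace X. f x \<in> B}
      \<subseteq> {x \<in> topspace X. filter_L X f x \<in> W}"
  proof clarify
    fix x assume x: "x \<in> topspace X" "filter_unit X x \<in> A" "f x \<in> B"
    \<comment> \<open>Lying in Kf supplies the order condition in \<open>WT\<close>; only membership
      in \<open>A \<times> B\<close> then remains.\<close>
    have "filter_L X f x \<in> topspace (filter_K X Y f)"
      using L x(1) by (auto simp: continuous_map_def)
    with x AB show "filter_L X f x \<in> W"
      by (auto simp: WT filter_K_def topspace_comma filter_L_def)
  qed
  ultimately show ?thesis
    by (rule open_filter_mono[OF fil])
qed

theorem theorem13p2:
  fixes X :: "'a topology" and Y :: "'b topology" and f :: "'a \<Rightarrow> 'b"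
  assumes "t0_space X" and "t0_space Y" and "continuous_map X Y f"
  shows "hom_le (filter_space (filter_K X Y f)) (filter_space (filter_K X Y f))
    (filter_map X (filter_K X Y f) (filter_L X f)
      \<circ> filter_mult X
      \<circ> filter_map (filter_K X Y f) (filter_space X) filter_q)
    id"
  unfolding hom_le_def space_le_filter_space topspace_filter_space comp_apply id_apply
proof (intro ballI conjI subsetI)
  let ?K = "filter_K X Y f"
  note L = continuous_map_filter_L[OF assms(3)]
  fix \<Theta> assume "\<Theta> \<in> {\<Theta>. open_filter ?K \<Theta>}"
  then have \<Theta>: "open_filter ?K \<Theta>" by simp
  then show "open_filter ?K \<Theta>" .
  show "open_filter ?K (filter_map X ?K (filter_L X f)
      (filter_mult X (filter_map ?K (filter_space X) filter_q \<Theta>)))"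
    by (intro open_filter_filter_map open_filter_filter_mult L continuous_map_filter_q \<Theta>)
  \<comment> \<open>By reverse inclusion, \<le> \<open>id\<close> means that \<open>\<Theta>\<close>
    is contained in its image.\<close>
  fix W assume "W \<in> \<Theta>"
  then have W: "openin ?K W" using \<Theta> open_filter_openin by blast
  let ?V = "{x \<in> topspace X. filter_L X f x \<in> W}"
  have V: "openin X ?V" using L W by (rule openin_continuous_map_preimage)
  \<comment> \<open>Unfolding the three maps, the open set \<open>W\<close> lies in the image of
    \<open>\<Theta>\<close> exactly when \<open>?S\<close> lies in \<open>\<Theta>\<close>.\<close>
  let ?S = "{p \<in> topspace ?K. filter_q p \<in> sharp X ?V}"
  have "W \<subseteq> ?S"
  proof
    fix p assume p: "p \<in> W"
    then have K: "p \<in> topspace ?K" using openin_subset[OF W] by blast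
    have "?V \<in> filter_q p"
      using filter_L_preimage_mem[OF assms(3) W, of "fst p" "snd p"] p by (simp add: filter_q_def)
    moreover have "open_filter X (filter_q p)"
      using K continuous_map_filter_q[of X Y f]
      by (auto simp: continuous_map_def topspace_filter_space)
    ultimately show "p \<in> ?S" using K by (simp add: sharp_def)
  qed
  moreover have "openin ?K ?S"
    using continuous_map_filter_q openin_sharp[OF V] by (rule openin_continuous_map_preimage)
  ultimately have "?S \<in> \<Theta>"
    using open_filter_mono[OF \<Theta> \<open>W \<in> \<Theta>\<close>] by blast
  then show "W \<in> filter_map X ?K (filter_L X f)
      (filter_mult X (filter_map ?K (filter_space X) filter_q \<Theta>))"
    using W V openin_sharp[OF V]
    by (simp add: filter_map_def[of X] filter_mult_def filter_map_def[of ?K])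
qed

end
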